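(* Let $N\ge1$ be an integer, $a>0$, $T>0$, $L>0$, and set $$Q:=[0,T]\times[-L,L]^N,\qquad \Gamma:=\left([0,T]\times\left(\{0\}\cup\partial[-L,L]^N\right)\right)\cup\left(\{0\}\times[-L,L]^N\right).$$ Let $v=v(t,x)$ be a real-valued function on $Q$ satisfying: 1. $v$ is continuous on $Q$; 2. $v$ is of class $C^1$ in $t$; 3. $v$ is of class $C^2$ in $x$ on $[-L,L]^N\setminus\{0\}$; 4. $v_t=\frac1a|x|^{2-a}\Delta v$ (for $x\neq0$). Then $$\max_{(t,x)\in Q}v(t,x)\le\max_{(t,x)\in\Gamma}v(t,x).$$
   Context: $\Delta$ is the Euclidean Laplacian in the variable $x\in\mathbb{R}^N$, $v_t=\partial v/\partial t$, $\partial[-L,L]^N$ is the topological boundary of the cube. Derivatives at boundary points of $Q$ are understood as one-sided. *)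

theory Defs
  imports "HOL-Analysis.Analysis"
begin

definition cube :: "real \<Rightarrow> (real ^ 'n) set" where
  "cube L = cbox (\<chi> i. - L) (\<chi> i. L)"

definition cylinder :: "real \<Rightarrow> real \<Rightarrow> (real \<times> (real ^ 'n)) set" where
  "cylinder T L = {0..T} \<times> cube L"

definition parabolic_bdry :: "real \<Rightarrow> real \<Rightarrow> (real \<times> (real ^ 'n)) set" where
  "parabolic_bdry T L = ({0..T} \<times> ({0} \<union> frontier (cube L))) \<union> ({0} \<times> cube L)"

text \<open>Partial derivatives relative to a set \<open>S\<close>: only increments along the \<open>i\<close>-th axis that
  stay in \<open>S\<close> are used. At interior points of \<open>S\<close> this is the ordinary partial derivative;
  on a face of the cube orthogonal to the \<open>i\<close>-th axis it is the one-sided one.\<close>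

definition axis_section :: "(real ^ 'n) set \<Rightarrow> 'n \<Rightarrow> real ^ 'n \<Rightarrow> real set" where
  "axis_section S i x = {s. x + s *\<^sub>R axis i 1 \<in> S}"

definition partially_differentiable ::
    "(real ^ 'n) set \<Rightarrow> 'n \<Rightarrow> (real ^ 'n \<Rightarrow> real) \<Rightarrow> real ^ 'n \<Rightarrow> bool" where
  "partially_differentiable S i u x \<longleftrightarrow>
     (\<lambda>s. u (x + s *\<^sub>R axis i 1)) differentiable (at 0 within axis_section S i x)"

definition partial_deriv ::
    "(real ^ 'n) set \<Rightarrow> 'n \<Rightarrow> (real ^ 'n \<Rightarrow> real) \<Rightarrow> real ^ 'n \<Rightarrow> real" where
  "partial_deriv S i u x =
     vector_derivative (\<lambda>s. u (x + s *\<^sub>R axis i 1)) (at 0 within axis_section S i x)"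

definition C1_space :: "(real ^ 'n) set \<Rightarrow> (real ^ 'n \<Rightarrow> real) \<Rightarrow> bool" where
  "C1_space S u \<longleftrightarrow> continuous_on S u \<and>
     (\<forall>i. (\<forall>x\<in>S. partially_differentiable S i u x) \<and> continuous_on S (partial_deriv S i u))"

definition C2_space :: "(real ^ 'n) set \<Rightarrow> (real ^ 'n \<Rightarrow> real) \<Rightarrow> bool" where
  "C2_space S u \<longleftrightarrow> C1_space S u \<and> (\<forall>i. C1_space S (partial_deriv S i u))"

definition laplacian :: "(real ^ 'n) set \<Rightarrow> (real ^ 'n \<Rightarrow> real) \<Rightarrow> real ^ 'n \<Rightarrow> real" where
  "laplacian S u x = (\<Sum>i\<in>UNIV. partial_deriv S i (partial_deriv S i u) x)"

text \<open>The library's \<open>C1_differentiable_on\<close> demands two-sided derivatives; here the derivative at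
  an endpoint of the interval \<open>I\<close> is one-sided.\<close>

definition C1_time :: "real set \<Rightarrow> (real \<Rightarrow> real) \<Rightarrow> bool" where
  "C1_time I f \<longleftrightarrow> f differentiable_on I \<and>
     continuous_on I (\<lambda>t. vector_derivative f (at t within I))"

end

theory Submission imports Defs begin

text \<open>If \<open>v\<close> exceeded its maximum over the parabolic boundary, then so would
  \<open>v - \<epsilon> t\<close> for small \<open>\<epsilon> > 0\<close>, and a maximum point of the latter would have \<open>t > 0\<close> and
  \<open>x\<close> nonzero and interior to the cube. There \<open>v\<^sub>t \<ge> \<epsilon> > 0\<close>, whereas all pure second
  derivatives in space are nonpositive, which contradicts the equation.\<close>

text \<open>Fermat's rule gives \<open>g' c = 0\<close>. If \<open>D\<close> were positive,
  \<open>g'\<close> would be positive just to the right of \<open>c\<close>, and the mean value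
  theorem would make \<open>g\<close> exceed \<open>g c\<close> there.\<close>

lemma second_derivative_nonpos_at_local_max:
  fixes g g' :: "real \<Rightarrow> real"
  assumes g: "\<forall>\<^sub>F s in nhds c. (g has_real_derivative g' s) (at s)"
    and g': "(g' has_real_derivative D) (at c)"
    and max: "\<forall>\<^sub>F s in nhds c. g s \<le> g c"
  shows "D \<le> 0"
proof (rule ccontr)
  assume "\<not> D \<le> 0"
  then obtain d1 where d1: "d1 > 0" "\<And>h. 0 < h \<Longrightarrow> h < d1 \<Longrightarrow> g' c < g' (c + h)"
    using DERIV_pos_inc_right[OF g'] by fastforce
  obtain d2 where d2: "d2 > 0"
    "\<And>s. dist s c < d2 \<Longrightarrow> (g has_real_derivative g' s) (at s) \<and> g s \<le> g c"
    using eventually_conj[OF g max] unfolding eventually_nhds_metric by blast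
  have zero: "g' c = 0"
    by (rule DERIV_local_max[of g _ c d2])
      (use d2 in \<open>auto simp: dist_real_def abs_minus_commute\<close>)
  define h where "h = min d1 d2 / 2"
  have h: "0 < h" "h < d1" "h < d2" using d1(1) d2(1) by (auto simp: h_def min_def)
  obtain z where z: "c < z" "z < c + h" "g (c + h) - g c = (c + h - c) * g' z"
    using MVT2[of c "c + h" g g'] d2(2) h by (force simp: dist_real_def)
  have "g' z > 0" using d1(2)[of "z - c"] z h zero by simp
  then have "g (c + h) > g c" using z h by (simp add: algebra_simps)
  with d2(2)[of "c + h"] h show False by (simp add: dist_real_def)
qed

text \<open>For \<open>s < t\<close> the increment satisfies
  \<open>f s - f t \<le> e * (s - t)\<close>; dividing by the negative \<open>s - t\<close> bounds
  every left difference quotient below by \<open>e\<close>. Only left increments enter, so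
  \<open>t = b\<close> is covered, and \<open>a < t\<close> makes the left limit nontrivial.\<close>

lemma one_sided_derivative_ge:
  fixes f :: "real \<Rightarrow> real"
  assumes "(f has_real_derivative D) (at t within {a..b})"
    and t: "a < t" "t \<le> b"
    and le: "\<And>s. a \<le> s \<Longrightarrow> s \<le> t \<Longrightarrow> f s - e * s \<le> f t - e * t"
  shows "e \<le> D"
proof -
  have "(f has_real_derivative D) (at t within {a..t})"
    using assms(1) by (rule has_field_derivative_subset) (use t in auto)
  then have "((\<lambda>s. (f s - f t) / (s - t)) \<longlongrightarrow> D) (at t within {a..t})"
    by (simp add: has_field_derivative_iff)
  moreover have "\<forall>\<^sub>F s in at t within {a..t}. e \<le> (f s - f t) / (s - t)"
    using le by (auto simp: eventually_at_filter neg_le_divide_eq algebra_simps intro!: always_eventually)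
  moreover have "at t within {a..t} \<noteq> bot"
    using t by (simp add: trivial_limit_within islimpt_Icc)
  ultimately show ?thesis by (rule tendsto_lowerbound)
qed

text \<open>At an interior point the axis section is a neighbourhood of 0, so the relative
  derivative is an ordinary two-sided one.\<close>

lemma partial_deriv_has_derivative:
  assumes "partially_differentiable S i u x" and "x \<in> interior S"
  shows "((\<lambda>s. u (x + s *\<^sub>R axis i 1)) has_real_derivative partial_deriv S i u x) (at 0)"
proof -
  have "open ((\<lambda>s. x + s *\<^sub>R axis i 1) -` interior S)"
    by (intro continuous_open_vimage continuous_intros) auto
  then have "0 \<in> interior (axis_section S i x)"
    by (rule interiorI) (use assms(2) interior_subset[of S] in \<open>auto simp: axis_section_def\<close>)
  then have "at 0 within axis_section S i x = at 0"
    by (rule at_within_interior)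
  then show ?thesis using assms(1)
    by (simp add: partially_differentiable_def partial_deriv_def vector_derivative_works
        has_real_derivative_iff_has_vector_derivative)
qed

text \<open>Restricting \<open>u\<close> to the line through \<open>x\<close> along the
  \<open>i\<close>-th axis reduces the claim to the one-variable second derivative test.\<close>

lemma second_partial_nonpos_at_max:
  assumes C2: "C2_space S u" and x: "x \<in> interior S"
    and max: "\<And>y. y \<in> S \<Longrightarrow> u y \<le> u x"
  shows "partial_deriv S i (partial_deriv S i u) x \<le> 0"
proof -
  define l where "l s = x + s *\<^sub>R axis i 1" for s :: real
  have "open (l -` interior S)" unfolding l_def
    by (intro continuous_open_vimage continuous_intros) auto
  moreover have "0 \<in> l -` interior S" using x by (simp add: l_def)
  ultimately have ev: "\<forall>\<^sub>F s in nhds 0. l s \<in> interior S"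
    using eventually_nhds_in_open by fastforce
  have S: "y \<in> S" if "y \<in> interior S" for y using that interior_subset by blast
  have "((\<lambda>s. u (l s)) has_real_derivative partial_deriv S i u (l r)) (at r)"
    if "l r \<in> interior S" for r
  proof -
    \<comment> \<open>A partial derivative is taken at parameter 0 of the line based at
      \<open>l r\<close>. Writing 0 as \<open>r - r\<close> prepares the chain rule with the shift
      \<open>s - r\<close>, which returns to the line based at \<open>x\<close>.\<close>
    have "((\<lambda>s. u (l r + s *\<^sub>R axis i 1)) has_real_derivative partial_deriv S i u (l r)) (at (r - r))"
      using partial_deriv_has_derivative[OF _ that, of i u] C2 S[OF that]
      by (simp add: C2_space_def C1_space_def)
    then have "((\<lambda>s. u (l r + (s - r) *\<^sub>R axis i 1)) has_real_derivative
        partial_deriv S i u (l r) * 1) (at r)"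
      by (rule DERIV_chain2) (auto intro!: derivative_eq_intros)
    then show ?thesis by (simp add: l_def algebra_simps)
  qed
  with ev have "\<forall>\<^sub>F s in nhds 0. ((\<lambda>s. u (l s)) has_real_derivative partial_deriv S i u (l s)) (at s)"
    by (auto elim: eventually_mono)
  moreover have "((\<lambda>s. partial_deriv S i u (l s)) has_real_derivative
      partial_deriv S i (partial_deriv S i u) x) (at 0)"
    using partial_deriv_has_derivative[OF _ x] C2 S[OF x]
    by (simp add: C2_space_def C1_space_def l_def)
  moreover have "\<forall>\<^sub>F s in nhds 0. u (l s) \<le> u (l 0)"
    using ev by eventually_elim (use max S in \<open>simp add: l_def\<close>)
  ultimately show ?thesis by (rule second_derivative_nonpos_at_local_max)
qed

lemma compact_is_arg_max:
  fixes f :: "'a::topological_space \<Rightarrow> real"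
  assumes "compact K" "K \<noteq> {}" "continuous_on K f"
  obtains p where "is_arg_max f (\<lambda>z. z \<in> K) p"
  using continuous_attains_sup[OF assms] by (force simp: is_arg_max_def not_less)

theorem theorem4p19:
  fixes a T L :: real and v :: "real \<times> (real ^ 'n) \<Rightarrow> real"
  assumes "a > 0" and "T > 0" and "L > 0"
    and "continuous_on (cylinder T L) v"
    and "\<And>x. x \<in> cube L \<Longrightarrow> C1_time {0..T} (\<lambda>t. v (t, x))"
    and "\<And>t. t \<in> {0..T} \<Longrightarrow> C2_space (cube L - {0}) (\<lambda>x. v (t, x))"
    and "\<And>t x. (t, x) \<in> cylinder T L \<Longrightarrow> x \<noteq> 0 \<Longrightarrow>
           vector_derivative (\<lambda>s. v (s, x)) (at t within {0..T})
             = 1 / a * norm x powr (2 - a) * laplacian (cube L - {0}) (\<lambda>y. v (t, y)) x"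
  shows "\<exists>p q. is_arg_max v (\<lambda>z. z \<in> cylinder T L) p
             \<and> is_arg_max v (\<lambda>z. z \<in> parabolic_bdry T L) q
             \<and> v p \<le> v q"
proof -
  let ?Q = "cylinder T L :: (real \<times> (real ^ 'n)) set"
  let ?G = "parabolic_bdry T L :: (real \<times> (real ^ 'n)) set"
  let ?C = "cube L :: (real ^ 'n) set"
  have C: "compact ?C" "0 \<in> ?C"
    using \<open>L > 0\<close> by (auto simp: cube_def mem_box_cart)
  then have fr: "frontier ?C \<subseteq> ?C" "compact (frontier ?C)"
    using frontier_subset_compact compact_frontier by auto
  have Q: "compact ?Q" using C by (simp add: cylinder_def compact_Times)
  have G: "compact ?G"
    using C fr by (simp add: parabolic_bdry_def compact_Times compact_Un compact_insert)
  have GQ: "?G \<subseteq> ?Q" and "(0, 0) \<in> ?G"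
    using C fr \<open>T > 0\<close> by (auto simp: parabolic_bdry_def cylinder_def)
  then have ne: "?G \<noteq> {}" "?Q \<noteq> {}" by auto
  obtain p where p: "is_arg_max v (\<lambda>z. z \<in> ?Q) p"
    using compact_is_arg_max[OF Q ne(2) assms(4)] .
  obtain q where q: "is_arg_max v (\<lambda>z. z \<in> ?G) q"
    using compact_is_arg_max[OF G ne(1) continuous_on_subset[OF assms(4) GQ]] .
  have "v p \<le> v q"
  proof (rule ccontr)
    assume "\<not> v p \<le> v q"
    \<comment> \<open>With this choice \<open>e * T\<close> is half the gap
      \<open>v p - v q\<close>, so the penalty \<open>e * t\<close> cannot close the gap for any
      \<open>t \<le> T\<close>.\<close>
    define e where "e = (v p - v q) / (2 * T)"
    have e: "e > 0" "e * T < v p - v q"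
      using \<open>\<not> v p \<le> v q\<close> \<open>T > 0\<close> by (auto simp: e_def)
    have "continuous_on ?Q (\<lambda>z. v z - e * fst z)"
      by (intro continuous_intros assms(4))
    then obtain m where m: "is_arg_max (\<lambda>z. v z - e * fst z) (\<lambda>z. z \<in> ?Q) m"
      using compact_is_arg_max[OF Q ne(2)] by blast
    obtain t x where tx: "m = (t, x)" by (cases m)
    have mQ: "(t, x) \<in> ?Q" and max: "\<And>s y. (s, y) \<in> ?Q \<Longrightarrow> v (s, y) - e * s \<le> v (t, x) - e * t"
      using m by (force simp: is_arg_max_def tx not_less)+
    then have t: "0 \<le> t" "t \<le> T" and xC: "x \<in> ?C" by (auto simp: cylinder_def)
    \<comment> \<open>On \<open>?G\<close> the maximum of the penalized function would be at most
      \<open>v q\<close>, but its value at \<open>p\<close> is at least \<open>v p - e * T\<close>,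
      which is larger.\<close>
    have "(t, x) \<notin> ?G"
    proof
      assume "(t, x) \<in> ?G"
      then have "v (t, x) \<le> v q" using q by (auto simp: is_arg_max_def not_less)
      moreover have pQ: "(fst p, snd p) \<in> ?Q" using p by (simp add: is_arg_max_def)
      moreover from pQ have "fst p \<le> T" by (auto simp: cylinder_def)
      moreover have "e * fst p \<le> e * T" "0 \<le> e * t" using e(1) t \<open>fst p \<le> T\<close> by auto
      ultimately show False using max[OF pQ] e(2) by simp
    qed
    then have t0: "0 < t" and x0: "x \<noteq> 0" and xf: "x \<notin> frontier ?C"
      using t xC by (auto simp: parabolic_bdry_def less_le)
    have "x \<in> interior ?C - {0}"
      using xf x0 xC closure_subset[of ?C] by (auto simp: frontier_def)
    \<comment> \<open>Removing the closed set \<open>{0}\<close> from the open interior leaves an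
      open set.\<close>
    moreover have "interior ?C - {0} \<subseteq> interior (?C - {0})"
      by (rule interior_maximal) (use interior_subset[of ?C] in auto)
    ultimately have xint: "x \<in> interior (?C - {0})" by blast
    \<comment> \<open>At fixed \<open>t\<close> the penalty is constant, so \<open>x\<close> also
      maximizes \<open>v (t, y)\<close> over \<open>y\<close>.\<close>
    have "laplacian (?C - {0}) (\<lambda>y. v (t, y)) x \<le> 0"
      unfolding laplacian_def
      by (intro sum_nonpos second_partial_nonpos_at_max[OF assms(6) xint])
        (use max t in \<open>force simp: cylinder_def\<close>)+
    then have "vector_derivative (\<lambda>s. v (s, x)) (at t within {0..T}) \<le> 0"
      using assms(7)[OF mQ x0] \<open>a > 0\<close> by (simp add: mult_nonneg_nonpos divide_nonpos_pos)
    moreover have "((\<lambda>s. v (s, x)) has_real_derivative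
        vector_derivative (\<lambda>s. v (s, x)) (at t within {0..T})) (at t within {0..T})"
      using assms(5)[OF xC] t by (simp add: C1_time_def differentiable_on_def
          vector_derivative_works has_real_derivative_iff_has_vector_derivative)
    \<comment> \<open>The maximum may lie at \<open>t = T\<close>, so only earlier times are
      compared.\<close>
    then have "e \<le> vector_derivative (\<lambda>s. v (s, x)) (at t within {0..T})"
      by (rule one_sided_derivative_ge[OF _ t0 t(2)])
        (use max t xC in \<open>auto simp: cylinder_def\<close>)
    ultimately show False using e(1) by simp
  qed
  with p q show ?thesis by blast
qed

end
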